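(* Let $\gamma:I\to\mathbb{R}^2\setminus\{0\}$ be a unit speed plane curve with unit normal $n$ such that $\langle\gamma(s),n(s)\rangle\neq0$, and let $\phi\in[0,2\pi)$. Then $$\mathrm{Pr}[\phi]_\gamma(s)=\cos\phi\,R(\phi)\,\mathrm{Pr}_\gamma(s)=\cos\phi\,\mathrm{Pr}_{\gamma_\phi}(s)=\mathrm{Pr}_{\cos\phi\,\gamma_\phi}(s).$$
   Context: $I\subset\mathbb{R}$ is an interval, $J=\begin{pmatrix}0&-1\\1&0\end{pmatrix}$, $t=\gamma'$ is the unit tangent vector and $n=Jt$ the unit normal vector of $\gamma$. $R(\phi)=\begin{pmatrix}\cos\phi&-\sin\phi\\ \sin\phi&\cos\phi\end{pmatrix}$ is the rotation matrix, and $\gamma_\phi(s)=R(\phi)\gamma(s)$ is the $\phi$-rotated curve. Primitive: the primitive $\mathrm{Pr}_c$ of a plane curve $c$ is the envelope of the lines through $c(s)$ orthogonal to the position vector $c(s)$, i.e. of the lines $\{x:\langle x-c(s),c(s)\rangle=0\}_{s\in I}$. It is parametrized by $\mathrm{Pr}_c(s)=2c(s)-\frac{\|c(s)\|^2}{\langle n_c(s),c(s)\rangle}n_c(s)$, where $n_c=J\,c'/\|c'\|$ is the unit normal vector of $c$. $\phi$-slant primitivoid: put $\mathbb{N}[\phi](s)=\cos\phi\,\gamma(s)+\sin\phi\,J\gamma(s)$ and define $F:I\times(\mathbb{R}^2\setminus\{0\})\to\mathbb{R}$ by $F(s,x)=\langle x-\gamma(s),\mathbb{N}[\phi](s)\rangle$.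 For each $s$, $F(s,x)=0$ is the equation of the line through $\gamma(s)$ orthogonal to $\mathbb{N}[\phi](s)$. The $\phi$-slant primitivoid $\mathrm{Pr}[\phi]_\gamma$ of $\gamma$ is the envelope of this family of lines, $\mathrm{Pr}[\phi]_\gamma(s)$ being the point $x$ determined by $F(s,x)=\frac{\partial F}{\partial s}(s,x)=0$.
   Formalization: The envelope point x ranges over all of R^2 instead of R^2 minus 0, and the primitive of the constant curve 0 is taken to be 0; this matters only when cos φ = 0, where the envelope point is 0 and the claim as written is undefined. *)

theory Defs
  imports "HOL-Analysis.Analysis"
begin

definition J :: "real^2^2" where
  "J = vector [vector [0, -1], vector [1, 0]]"

definition rot :: "real \<Rightarrow> real^2^2" where
  "rot \<phi> = vector [vector [cos \<phi>, - sin \<phi>], vector [sin \<phi>, cos \<phi>]]"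

definition rotated :: "real \<Rightarrow> (real \<Rightarrow> real^2) \<Rightarrow> real \<Rightarrow> real^2" where
  "rotated \<phi> \<gamma> s = rot \<phi> *v \<gamma> s"

text \<open>A curve is a function on the reals of which only the values on the interval \<open>I\<close> matter;
  derivatives are taken within \<open>I\<close> (one-sided at endpoints contained in \<open>I\<close>). They are
  meaningful only if \<open>I\<close> has more than one point.\<close>

definition nontrivial_interval :: "real set \<Rightarrow> bool" where
  "nontrivial_interval I \<longleftrightarrow> is_interval I \<and> (\<exists>a\<in>I. \<exists>b\<in>I. a < b)"

definition velocity :: "real set \<Rightarrow> (real \<Rightarrow> real^2) \<Rightarrow> real \<Rightarrow> real^2" where
  "velocity I c s = vector_derivative c (at s within I)"

definition unit_speed_on :: "real set \<Rightarrow> (real \<Rightarrow> real^2) \<Rightarrow> bool" where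
  "unit_speed_on I \<gamma> \<longleftrightarrow>
     (\<forall>s\<in>I. \<gamma> differentiable (at s within I) \<and> norm (velocity I \<gamma> s) = 1)"

definition unit_normal :: "real set \<Rightarrow> (real \<Rightarrow> real^2) \<Rightarrow> real \<Rightarrow> real^2" where
  "unit_normal I c s = J *v (velocity I c s /\<^sub>R norm (velocity I c s))"

text \<open>\<open>F s x = 0\<close> is the equation of the \<open>s\<close>-th line; the second conjunct says that the partial
  derivative of \<open>F\<close> with respect to \<open>s\<close> exists and vanishes at \<open>(s, x)\<close>.\<close>

definition envelope_point ::
    "real set \<Rightarrow> (real \<Rightarrow> real^2 \<Rightarrow> real) \<Rightarrow> real \<Rightarrow> real^2 \<Rightarrow> bool" where
  "envelope_point I F s x \<longleftrightarrow>
     F s x = 0 \<and> ((\<lambda>u. F u x) has_real_derivative 0) (at s within I)"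

text \<open>The primitive is given by its parametrization; \<open>envelope_point_primitive\<close> below shows that
  this is the envelope of the lines through \<open>c s\<close> orthogonal to \<open>c s\<close>. For the constant curve
  \<open>c = 0\<close>, where that family of lines degenerates, the formula returns \<open>0\<close> because \<open>0 / 0 = 0\<close>.\<close>

definition primitive :: "real set \<Rightarrow> (real \<Rightarrow> real^2) \<Rightarrow> real \<Rightarrow> real^2" where
  "primitive I c s =
     2 *\<^sub>R c s - ((norm (c s))\<^sup>2 / (unit_normal I c s \<bullet> c s)) *\<^sub>R unit_normal I c s"

definition slant_normal :: "real \<Rightarrow> (real \<Rightarrow> real^2) \<Rightarrow> real \<Rightarrow> real^2" where
  "slant_normal \<phi> \<gamma> s = cos \<phi> *\<^sub>R \<gamma> s + sin \<phi> *\<^sub>R (J *v \<gamma> s)"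

definition slant_family :: "real \<Rightarrow> (real \<Rightarrow> real^2) \<Rightarrow> real \<Rightarrow> real^2 \<Rightarrow> real" where
  "slant_family \<phi> \<gamma> s x = (x - \<gamma> s) \<bullet> slant_normal \<phi> \<gamma> s"

text \<open>The point \<open>x\<close> ranges over the whole plane: for \<open>cos \<phi> = 0\<close> all the lines pass
  through the origin, and the envelope point is \<open>0\<close>. The description is proper by
  \<open>slant_primitivoid_well_defined\<close> below.\<close>

definition slant_primitivoid ::
    "real set \<Rightarrow> real \<Rightarrow> (real \<Rightarrow> real^2) \<Rightarrow> real \<Rightarrow> real^2" where
  "slant_primitivoid I \<phi> \<gamma> s = (THE x. envelope_point I (slant_family \<phi> \<gamma>) s x)"

lemma J_mult: "J *v v = vector [- v$2, v$1]"
  by (simp add: vec_eq_iff J_def matrix_vector_mult_def sum_2 forall_2)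

lemma inner_J_rotation:
  "(p *\<^sub>R a + q *\<^sub>R (J *v a)) \<bullet> (J *v (p *\<^sub>R b + q *\<^sub>R (J *v b)))
    = (p * p + q * q) * (a \<bullet> (J *v b))"
  unfolding J_mult inner_vec_def sum_2 vector_2 vector_add_component
    vector_scaleR_component inner_real_def real_scaleR_def
  by (simp add: algebra_simps)

lemma nontrivial_interval_at_within:
  assumes "nontrivial_interval I" "s \<in> I"
  shows "at s within I \<noteq> bot"
proof -
  obtain a b where ab: "a \<in> I" "b \<in> I" "a < b" and "is_interval I"
    using assms(1) by (auto simp: nontrivial_interval_def)
  then have "connected I"
    by (simp add: is_interval_connected)
  moreover have "I \<noteq> {s}"
    using ab by auto
  ultimately have "s islimpt I"
    using assms(2) by (intro connected_imp_perfect) auto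
  then show ?thesis
    by (simp add: trivial_limit_within)
qed

lemma envelope_point_slant_family_iff:
  assumes "nontrivial_interval I" "s \<in> I" "c differentiable (at s within I)"
  shows "envelope_point I (slant_family \<phi> c) s x \<longleftrightarrow>
    (x - c s) \<bullet> slant_normal \<phi> c s = 0 \<and>
    (x - c s) \<bullet> (cos \<phi> *\<^sub>R velocity I c s + sin \<phi> *\<^sub>R (J *v velocity I c s))
      = velocity I c s \<bullet> slant_normal \<phi> c s"
proof -
  let ?v = "velocity I c s"
  let ?d = "(x - c s) \<bullet> (cos \<phi> *\<^sub>R ?v + sin \<phi> *\<^sub>R (J *v ?v)) - ?v \<bullet> slant_normal \<phi> c s"
  have bot: "at s within I \<noteq> bot"
    using assms by (intro nontrivial_interval_at_within)
  have c: "(c has_vector_derivative ?v) (at s within I)"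
    using assms(3) by (simp add: velocity_def vector_derivative_works)
  have J: "((\<lambda>u. J *v c u) has_vector_derivative J *v ?v) (at s within I)"
    using bounded_linear.has_vector_derivative[OF matrix_vector_mul_bounded_linear c] .
  have "((\<lambda>u. slant_family \<phi> c u x) has_vector_derivative ?d) (at s within I)"
    unfolding slant_family_def slant_normal_def
    by (rule bounded_bilinear.has_vector_derivative[OF bounded_bilinear_inner, THEN
          has_vector_derivative_eq_rhs])
       (auto intro!: derivative_eq_intros c J bounded_linear.has_vector_derivative[OF bounded_linear_scaleR_right])
  then have d: "((\<lambda>u. slant_family \<phi> c u x) has_real_derivative ?d) (at s within I)"
    by (simp add: has_real_derivative_iff_has_vector_derivative)
  then have "((\<lambda>u. slant_family \<phi> c u x) has_real_derivative 0) (at s within I) \<longleftrightarrow> ?d = 0"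
    by (metis bot has_real_derivative_iff_has_vector_derivative vector_derivative_within)
  then show ?thesis
    by (auto simp: envelope_point_def slant_family_def)
qed

lemma linear_system_ex1:
  fixes a b :: "real^2"
  assumes "a \<bullet> (J *v b) \<noteq> 0"
  shows "\<exists>!y. y \<bullet> a = 0 \<and> y \<bullet> b = k"
proof -
  define D where "D = a$1 * b$2 - a$2 * b$1"
  have D: "D \<noteq> 0"
    using assms by (simp add: D_def J_mult inner_vec_def sum_2 algebra_simps)
  define r where "r = k / D"
  define y :: "real^2" where "y = vector [- (r * a$2), r * a$1]"
  have y: "y \<bullet> a = 0 \<and> y \<bullet> b = k"
  proof
    show "y \<bullet> a = 0"
      by (simp add: y_def inner_vec_def sum_2)
    have "y \<bullet> b = r * D"
      by (simp add: y_def D_def inner_vec_def sum_2 right_diff_distrib)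
    then show "y \<bullet> b = k"
      using D by (simp add: r_def)
  qed
  have "z = y" if z: "z \<bullet> a = 0 \<and> z \<bullet> b = k" for z
  proof -
    define w where "w = z - y"
    have "w \<bullet> a = 0" "w \<bullet> b = 0"
      using y z by (auto simp: w_def inner_diff_left)
    then have e: "w$1 * a$1 + w$2 * a$2 = 0" "w$1 * b$1 + w$2 * b$2 = 0"
      by (auto simp: inner_vec_def sum_2)
    have "w$1 * D = (w$1 * a$1 + w$2 * a$2) * b$2 - (w$1 * b$1 + w$2 * b$2) * a$2"
      by (simp add: D_def algebra_simps)
    moreover
    have "w$2 * D = (w$1 * b$1 + w$2 * b$2) * a$1 - (w$1 * a$1 + w$2 * a$2) * b$1"
      by (simp add: D_def algebra_simps)
    ultimately have "w$1 = 0" "w$2 = 0"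
      using D unfolding e by auto
    then have "w = 0"
      by (simp add: vec_eq_iff forall_2)
    then show ?thesis
      by (simp add: w_def)
  qed
  with y show ?thesis
    by blast
qed

lemma slant_primitivoid_well_defined:
  assumes I: "nontrivial_interval I" "s \<in> I" and c: "c differentiable (at s within I)"
    and n: "unit_normal I c s \<bullet> c s \<noteq> 0"
  shows "\<exists>!x. envelope_point I (slant_family \<phi> c) s x"
proof -
  let ?v = "velocity I c s"
  let ?a = "slant_normal \<phi> c s"
  let ?b = "cos \<phi> *\<^sub>R ?v + sin \<phi> *\<^sub>R (J *v ?v)"
  have "?a \<bullet> (J *v ?b) = ((cos \<phi>)\<^sup>2 + (sin \<phi>)\<^sup>2) * (c s \<bullet> (J *v ?v))"
    unfolding slant_normal_def power2_eq_square by (rule inner_J_rotation)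
  moreover have "c s \<bullet> (J *v ?v) \<noteq> 0"
  proof
    assume "c s \<bullet> (J *v ?v) = 0"
    then have "unit_normal I c s \<bullet> c s = 0"
      by (simp add: unit_normal_def matrix_vector_mult_scaleR inner_commute[of _ "c s"])
    with n show False ..
  qed
  moreover have "(cos \<phi>)\<^sup>2 + (sin \<phi>)\<^sup>2 = 1"
    by (rule sin_cos_squared_add2)
  ultimately have "?a \<bullet> (J *v ?b) \<noteq> 0"
    by (metis mult_1)
  then obtain y where y: "y \<bullet> ?a = 0" "y \<bullet> ?b = ?v \<bullet> ?a"
    "\<And>z. z \<bullet> ?a = 0 \<Longrightarrow> z \<bullet> ?b = ?v \<bullet> ?a \<Longrightarrow> z = y"
    using linear_system_ex1[of ?a ?b "?v \<bullet> ?a"] by blast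
  show ?thesis
    unfolding envelope_point_slant_family_iff[OF I c]
  proof (intro ex1I[of _ "c s + y"])
    fix x
    assume "(x - c s) \<bullet> ?a = 0 \<and> (x - c s) \<bullet> ?b = ?v \<bullet> ?a"
    then have "x - c s = y"
      using y(3) by blast
    then show "x = c s + y"
      by (simp add: algebra_simps)
  qed (use y(1,2) in simp)
qed

lemma envelope_point_primitive:
  assumes I: "nontrivial_interval I" "s \<in> I" and c: "c differentiable (at s within I)"
    and n: "unit_normal I c s \<bullet> c s \<noteq> 0"
  shows "envelope_point I (\<lambda>u x. (x - c u) \<bullet> c u) s x \<longleftrightarrow> x = primitive I c s"
proof -
  let ?v = "velocity I c s"
  let ?n = "unit_normal I c s"
  have fam: "(\<lambda>u x. (x - c u) \<bullet> c u) = slant_family 0 c"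
    by (simp add: slant_family_def slant_normal_def fun_eq_iff)
  have "?n \<bullet> ?v = 0"
    by (simp add: unit_normal_def matrix_vector_mult_scaleR J_mult inner_vec_def sum_2)
  moreover have "(norm (c s))\<^sup>2 = c s \<bullet> c s"
    by (simp add: power2_norm_eq_inner)
  ultimately have "envelope_point I (slant_family 0 c) s (primitive I c s)"
    unfolding envelope_point_slant_family_iff[OF I c]
    using n by (simp add: primitive_def slant_normal_def inner_diff_left inner_commute[of "c s" ?v]
        inner_commute[of ?v ?n] inner_commute[of "c s" ?n])
  then show ?thesis
    unfolding fam using slant_primitivoid_well_defined[OF assms, of 0] by blast
qed

end

theory Submission
  imports Defs
begin

text \<open>With \<open>R = rot \<phi>\<close>, the slant line family has normal vectors \<open>R \<gamma>\<close> with derivative \<open>R \<gamma>'\<close>.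
  Since the symmetric part of \<open>R\<close> is \<open>cos \<phi>\<close> times the identity, the two linear equations for the
  envelope point are solved by \<open>cos \<phi>\<close> times the rotated solution for \<open>\<phi> = 0\<close>, which is the
  primitive. The remaining equalities say that the primitive commutes with rotations and
  homotheties.\<close>

lemma rot_mult: "rot \<phi> *v v = cos \<phi> *\<^sub>R v + sin \<phi> *\<^sub>R (J *v v)"
  by (simp add: vec_eq_iff J_def rot_def matrix_vector_mult_def sum_2 forall_2)

lemma rot_J: "rot \<phi> *v (J *v v) = J *v (rot \<phi> *v v)"
  by (simp add: rot_mult vec_eq_iff J_mult forall_2)

lemma inner_rot_rot: "(rot \<phi> *v v) \<bullet> (rot \<phi> *v w) = v \<bullet> w"
proof -
  have "(rot \<phi> *v v) \<bullet> (rot \<phi> *v w) = ((cos \<phi>)\<^sup>2 + (sin \<phi>)\<^sup>2) * (v \<bullet> w)"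
    unfolding rot_mult J_mult inner_vec_def sum_2 vector_2 vector_add_component
      vector_scaleR_component inner_real_def real_scaleR_def power2_eq_square
    by (simp only: ring_distribs minus_mult_left[symmetric] minus_mult_right[symmetric]) (simp only: algebra_simps)
  then show ?thesis
    by simp
qed

lemma norm_rot: "norm (rot \<phi> *v v) = norm v"
  by (simp add: norm_eq_sqrt_inner inner_rot_rot)

text \<open>\<open>J\<close> is skew-symmetric, so the two \<open>sin \<phi>\<close> terms
  cancel.\<close>

lemma inner_rot_symmetric_part: "v \<bullet> (rot \<phi> *v w) + w \<bullet> (rot \<phi> *v v) = 2 * cos \<phi> * (v \<bullet> w)"
  by (simp add: rot_mult J_mult inner_vec_def sum_2 algebra_simps)

lemma slant_normal_eq_rot: "slant_normal \<phi> c s = rot \<phi> *v c s"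
  by (simp add: slant_normal_def rot_mult)

text \<open>Serves rotations and homotheties alike. Nontriviality of \<open>I\<close> makes the
  derivative within \<open>I\<close> unique, so exhibiting one determines
  \<open>velocity\<close>.\<close>

lemma velocity_bounded_linear:
  assumes "nontrivial_interval I" "s \<in> I" "c differentiable (at s within I)" "bounded_linear f"
  shows "velocity I (\<lambda>u. f (c u)) s = f (velocity I c s)"
proof -
  have "(c has_vector_derivative velocity I c s) (at s within I)"
    using assms(3) by (simp add: velocity_def vector_derivative_works)
  then have "((\<lambda>u. f (c u)) has_vector_derivative f (velocity I c s)) (at s within I)"
    by (rule bounded_linear.has_vector_derivative[OF assms(4)])
  then show ?thesis
    unfolding velocity_def[of I "\<lambda>u. f (c u)"]
    by (rule vector_derivative_within[OF nontrivial_interval_at_within[OF assms(1,2)]])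
qed

text \<open>A rotation commutes with \<open>J\<close> and preserves norms and inner products, so it
  carries the unit normal along and leaves the coefficient of the normal unchanged.\<close>

lemma primitive_rotated:
  assumes "nontrivial_interval I" "s \<in> I" "c differentiable (at s within I)"
  shows "primitive I (rotated \<phi> c) s = rot \<phi> *v primitive I c s"
proof -
  have "velocity I (rotated \<phi> c) s = rot \<phi> *v velocity I c s"
    using velocity_bounded_linear[OF assms matrix_vector_mul_bounded_linear[of "rot \<phi>"]]
    by (simp add: rotated_def[abs_def])
  then have "unit_normal I (rotated \<phi> c) s = rot \<phi> *v unit_normal I c s"
    by (simp add: unit_normal_def norm_rot rot_J matrix_vector_mult_scaleR)
  then show ?thesis
    by (simp add: primitive_def rotated_def norm_rot inner_rot_rot
        matrix_vector_mult_diff_distrib matrix_vector_mult_scaleR)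
qed

text \<open>The normal changes only by \<open>sgn k\<close>. It enters once in the denominator and
  once as a vector, so its term is scaled by \<open>k * k / (sgn k * k) * sgn k\<close>, which is
  \<open>k\<close>.\<close>

lemma primitive_scaleR:
  assumes "nontrivial_interval I" "s \<in> I" "c differentiable (at s within I)"
  shows "primitive I (\<lambda>u. k *\<^sub>R c u) s = k *\<^sub>R primitive I c s"
proof (cases "k = 0")
  case False
  have "velocity I (\<lambda>u. k *\<^sub>R c u) s = k *\<^sub>R velocity I c s"
    using velocity_bounded_linear[OF assms bounded_linear_scaleR_right] .
  then have "unit_normal I (\<lambda>u. k *\<^sub>R c u) s = sgn k *\<^sub>R unit_normal I c s"
    by (simp add: unit_normal_def matrix_vector_mult_scaleR sgn_div_norm mult.commute)
  with False show ?thesis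
    by (simp add: primitive_def sgn_if power2_eq_square scaleR_diff_right ac_simps)
\<comment> \<open>This is the case \<open>cos \<phi> = 0\<close> of the theorem: the curve collapses
  to the origin, and the coefficient of its normal is \<open>0 / 0 = 0\<close>.\<close>
qed (simp add: primitive_def)

lemma slant_primitivoid_eq_primitive:
  assumes I: "nontrivial_interval I" "s \<in> I" and c: "c differentiable (at s within I)"
    and n: "unit_normal I c s \<bullet> c s \<noteq> 0"
  shows "slant_primitivoid I \<phi> c s = cos \<phi> *\<^sub>R (rot \<phi> *v primitive I c s)"
proof -
  let ?v = "velocity I c s"
  let ?P = "primitive I c s"
  have "envelope_point I (slant_family 0 c) s ?P"
    using envelope_point_primitive[OF assms, of ?P]
    by (simp add: slant_family_def[abs_def] slant_normal_def)
  \<comment> \<open>These are the two envelope equations for angle 0, solved for the products with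
    \<open>?P\<close>.\<close>
  then have P: "?P \<bullet> c s = c s \<bullet> c s" "?P \<bullet> ?v = 2 * (c s \<bullet> ?v)"
    unfolding envelope_point_slant_family_iff[OF I c]
    by (simp_all add: slant_normal_def inner_diff_left inner_commute[of ?v])
  have "envelope_point I (slant_family \<phi> c) s (cos \<phi> *\<^sub>R (rot \<phi> *v ?P))"
    unfolding envelope_point_slant_family_iff[OF I c] rot_mult[symmetric] slant_normal_eq_rot
    \<comment> \<open>The first instance gives the line equation. The second matches the factor 2 in
      \<open>P\<close> and gives the equation for the derivative.\<close>
    using inner_rot_symmetric_part[of "c s" \<phi> "c s"] inner_rot_symmetric_part[of "c s" \<phi> ?v]
    by (simp add: inner_diff_left inner_rot_rot P)
  then show ?thesis
    unfolding slant_primitivoid_def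
    using slant_primitivoid_well_defined[OF assms] by (intro the1_equality)
qed

theorem theorem4p4:
  fixes I :: "real set" and \<gamma> :: "real \<Rightarrow> real^2" and \<phi> :: real
  assumes "nontrivial_interval I"
    and "\<forall>s\<in>I. \<gamma> s \<noteq> 0"
    and "unit_speed_on I \<gamma>"
    and "\<forall>s\<in>I. \<gamma> s \<bullet> unit_normal I \<gamma> s \<noteq> 0"
    and "0 \<le> \<phi>" and "\<phi> < 2 * pi"
  shows "\<forall>s\<in>I.
      slant_primitivoid I \<phi> \<gamma> s = cos \<phi> *\<^sub>R (rot \<phi> *v primitive I \<gamma> s)
    \<and> cos \<phi> *\<^sub>R (rot \<phi> *v primitive I \<gamma> s) = cos \<phi> *\<^sub>R primitive I (rotated \<phi> \<gamma>) s
    \<and> cos \<phi> *\<^sub>R primitive I (rotated \<phi> \<gamma>) s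
        = primitive I (\<lambda>u. cos \<phi> *\<^sub>R rotated \<phi> \<gamma> u) s"
proof
  fix s
  assume s: "s \<in> I"
  have c: "\<gamma> differentiable (at s within I)"
    using assms(3) s by (simp add: unit_speed_on_def)
  \<comment> \<open>The homothety is applied after the rotation, so \<open>primitive_scaleR\<close>
    is used for the rotated curve.\<close>
  have r: "rotated \<phi> \<gamma> differentiable (at s within I)"
    using differentiable_compose[OF _ c, of "(*v) (rot \<phi>)"]
    by (simp add: rotated_def[abs_def] linear_imp_differentiable)
  have "unit_normal I \<gamma> s \<bullet> \<gamma> s \<noteq> 0"
    using assms(4) s by (simp add: inner_commute)
  then show "slant_primitivoid I \<phi> \<gamma> s = cos \<phi> *\<^sub>R (rot \<phi> *v primitive I \<gamma> s)
    \<and> cos \<phi> *\<^sub>R (rot \<phi> *v primitive I \<gamma> s) = cos \<phi> *\<^sub>R primitive I (rotated \<phi> \<gamma>) s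
    \<and> cos \<phi> *\<^sub>R primitive I (rotated \<phi> \<gamma>) s
        = primitive I (\<lambda>u. cos \<phi> *\<^sub>R rotated \<phi> \<gamma> u) s"
    using slant_primitivoid_eq_primitive[OF assms(1) s c]
      primitive_rotated[OF assms(1) s c] primitive_scaleR[OF assms(1) s r]
    by simp
qed

end
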